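(* Let $p$ be analytic in $\mathbb{D}$ with $p(0)=1$, let $\beta_0=1.1874$, and let $\beta$ be a real number with $\beta>\beta_0$. If $$p(z)+\frac{\beta zp'(z)}{p^3(z)}\prec\sqrt{1+z},$$ then $p(z)\prec\sqrt{1+z}$.
   Context: $\mathbb{D}=\{z\in\mathbb{C}:|z|<1\}$; $p^k(z)=(p(z))^k$. For analytic $f,g$ on $\mathbb{D}$, $f\prec g$ ($f$ is subordinate to $g$) means there is an analytic $w:\mathbb{D}\to\mathbb{D}$ with $w(0)=0$ and $f(z)=g(w(z))$ for all $z\in\mathbb{D}$; in particular the left-hand side of a subordination is understood to be an analytic function on $\mathbb{D}$. $\sqrt{1+z}$ is the principal branch; it maps $\mathbb{D}$ univalently onto $\{w:|w^2-1|<1,\ \operatorname{Re}w>0\}$. *)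

theory Defs
  imports "HOL-Complex_Analysis.Complex_Analysis"
begin

abbreviation unit_disc :: "complex set" ("\<D>")
  where "\<D> \<equiv> ball 0 1"

text \<open>
  Both sides of a subordination are required to be analytic on the unit disc. For a left-hand
  side such as \<open>p z + \<beta> * z * deriv p z / p z ^ 3\<close> with \<open>p 0 = 1\<close> this rules out zeros of \<open>p\<close> in
  the disc: at a zero the quotient has a pole, so the total function (whose value at the zero itself
  is given by \<open>x / 0 = 0\<close>) is unbounded nearby and not analytic. No separate hypothesis that \<open>p\<close>
  has no zeros is therefore needed.
\<close>
definition subordinate :: "(complex \<Rightarrow> complex) \<Rightarrow> (complex \<Rightarrow> complex) \<Rightarrow> bool" (infix "\<prec>" 50)
  where "f \<prec> g \<longleftrightarrow>
    f analytic_on \<D> \<and> g analytic_on \<D> \<and>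
    (\<exists>w. w analytic_on \<D> \<and> w ` \<D> \<subseteq> \<D> \<and> w 0 = 0 \<and> (\<forall>z\<in>\<D>. f z = g (w z)))"

end

theory Submission
  imports Defs
begin

text \<open>
  Put \<open>W = p\<^sup>2 - 1\<close>. If \<open>\<bar>W\<bar> < 1\<close> fails somewhere, let \<open>z\<close> be a point of smallest modulus
  where it fails. By Jack's lemma \<open>z W'(z) = m W(z)\<close> with \<open>m \<ge> 1\<close>, and since \<open>\<bar>W(z)\<bar> = 1\<close> this makes
  \<open>\<beta> z p'(z) / p(z)\<^sup>3\<close> the positive real number \<open>K = \<beta> m / (2 \<bar>p(z)\<bar>\<^sup>4)\<close>.
  Shifting the boundary point \<open>p(z)\<close> of the right loop of the lemniscate \<open>\<bar>w\<^sup>2 - 1\<bar> = 1\<close> by so large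
  a \<open>K\<close> leaves the loop, which contradicts the hypothesis.
\<close>

text \<open>By Schwarz, \<open>Re (W (z x) / W z) \<le> \<bar>x\<bar>\<close> with equality at \<open>x = 1\<close>; the directional derivatives of
  both sides at \<open>1\<close>, pointing into the disc, are compared.\<close>

lemma Jack:
  fixes W :: "complex \<Rightarrow> complex"
  assumes holo: "W holomorphic_on ball 0 R" and W0: "W 0 = 0"
    and z: "norm z < R" and Wz: "norm (W z) = 1"
    and less: "\<And>x. norm x < norm z \<Longrightarrow> norm (W x) < 1"
  obtains m :: real where "m \<ge> 1" "z * deriv W z = of_real m * W z"
proof -
  have nz: "z \<noteq> 0" "W z \<noteq> 0" using W0 Wz by auto
  \<comment> \<open>Scaling by \<open>z\<close> carries the unit disc onto the disc where
    \<open>less\<close> applies, so the Schwarz lemma covers \<open>W (z * x)\<close>.\<close>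
  have Schwarz: "norm (W (z * x)) \<le> norm x" if x: "norm x < 1" for x
  proof (rule Schwarz_Lemma(1)[where f = "\<lambda>x. W (z * x)"])
    have *: "norm (z * x) < norm z" if "norm x < 1" for x
      using that nz by (simp add: norm_mult)
    have "W holomorphic_on (\<lambda>x. z * x) ` ball 0 1"
      by (rule holomorphic_on_subset[OF holo]) (use * z in force)
    then show "(\<lambda>x. W (z * x)) holomorphic_on ball 0 1"
      using holomorphic_on_compose[of "\<lambda>x. z * x" "ball 0 1" W]
      by (simp add: o_def holomorphic_intros)
    show "norm (W (z * x)) < 1" if "norm x < 1" for x
      using less[OF *[OF that]] .
  qed (use W0 x in auto)
  define D where "D = z * deriv W z / W z"
  have dir: "Re (D * d) \<le> Re d" if d: "Re d < 0" for d
  proof -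
    define \<phi> where "\<phi> = (\<lambda>s::real. Re (W (z * (1 + of_real s * d)) / W z))"
    have "(W has_field_derivative deriv W z) (at z)"
      by (rule holomorphic_derivI[OF holo]) (use z in auto)
    then have W': "(W has_field_derivative deriv W z) (at (z * (1 + of_real 0 * d)))"
      by simp
    have "((\<lambda>s::real. z * (1 + of_real s * d)) has_vector_derivative z * d) (at 0)"
      by (auto intro!: derivative_eq_intros)
    from field_vector_diff_chain_at[OF this W']
    have "((\<lambda>s::real. W (z * (1 + of_real s * d))) has_vector_derivative z * d * deriv W z) (at 0)"
      by (simp add: o_def)
    then have "((\<lambda>s::real. W (z * (1 + of_real s * d)) / W z) has_vector_derivative
        z * d * deriv W z / W z) (at 0)"
      by (rule has_vector_derivative_divide)
    then have "(\<phi> has_vector_derivative Re (D * d)) (at 0)"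
      unfolding \<phi>_def D_def
      using bounded_linear.has_vector_derivative[OF bounded_linear_Re] by (fastforce simp: mult_ac)
    then have "(\<phi> has_real_derivative Re (D * d)) (at 0)"
      by (simp add: has_real_derivative_iff_has_vector_derivative)
    then have lim: "((\<lambda>s. (\<phi> s - \<phi> 0) / s) \<longlongrightarrow> Re (D * d)) (at_right 0)"
      by (auto simp: DERIV_def intro: tendsto_within_subset)
    have lim2: "((\<lambda>s. Re d + s * (norm d)\<^sup>2 / 2) \<longlongrightarrow> Re d + 0 * (norm d)\<^sup>2 / 2) (at_right 0)"
      by (intro tendsto_intros) simp
    \<comment> \<open>For \<open>s > 0\<close> this bound is equivalent to
      \<open>norm (1 + of_real s * d) < 1\<close>; it is positive because
      \<open>Re d < 0\<close>.\<close>
    have "\<forall>\<^sub>F s in at_right 0. s < - 2 * Re d / (norm d)\<^sup>2"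
      by (rule order_tendstoD(2)[OF tendsto_ident_at]) (use d in \<open>auto intro!: divide_neg_pos\<close>)
    moreover have "\<forall>\<^sub>F s in at_right 0. s > (0::real)"
      by (simp add: eventually_at_right_less)
    ultimately have "\<forall>\<^sub>F s in at_right 0. (\<phi> s - \<phi> 0) / s \<le> Re d + s * (norm d)\<^sup>2 / 2"
    proof eventually_elim
      case (elim s)
      define x where "x = 1 + of_real s * d"
      have sq: "(norm x)\<^sup>2 = 1 + 2 * s * Re d + s\<^sup>2 * (norm d)\<^sup>2"
        unfolding x_def cmod_power2 by (simp add: power2_eq_square algebra_simps)
      have "d \<noteq> 0" using d by auto
      then have "s * (norm d)\<^sup>2 < - 2 * Re d"
        using elim(1) by (simp add: field_simps)
      then have "s * (s * (norm d)\<^sup>2) < s * (- 2 * Re d)"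
        using elim(2) by (rule mult_strict_left_mono)
      then have "(norm x)\<^sup>2 < 1" unfolding sq by (simp add: power2_eq_square algebra_simps)
      then have "norm x < 1" by (simp add: power_less_one_iff abs_square_less_1)
      then have "norm (W (z * x)) \<le> norm x" by (rule Schwarz)
      moreover have "\<phi> s \<le> norm (W (z * x) / W z)"
        unfolding \<phi>_def x_def by (rule complex_Re_le_cmod)
      \<comment> \<open>This replaces the norm by a quadratic polynomial in \<open>s\<close> with
        the same value and slope at \<open>s = 0\<close>, so that no norm has to be
        differentiated.\<close>
      moreover have "norm x \<le> (1 + (norm x)\<^sup>2) / 2"
        using sum_squares_bound[of 1 "norm x"] by simp
      ultimately have "\<phi> s - 1 \<le> s * Re d + s\<^sup>2 * (norm d)\<^sup>2 / 2"
        by (simp add: norm_divide Wz sq)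
      moreover have "\<phi> 0 = 1" using nz by (simp add: \<phi>_def)
      ultimately show ?case
        using elim(2) by (simp add: field_simps power2_eq_square)
    qed
    from tendsto_le[OF _ lim2 lim this] show ?thesis by simp
  qed
  have "Re D \<ge> 1" using dir[of "-1"] by simp
  moreover have "Im D = 0"
  proof (rule ccontr)
    assume "Im D \<noteq> 0"
    \<comment> \<open>The imaginary part is chosen to make \<open>Re (D * d)\<close> at least 2,
      while \<open>Re d = -1\<close>.\<close>
    define d where "d = Complex (-1) (- (\<bar>Re D\<bar> + 2) / Im D)"
    have "Re (D * d) = - Re D + (\<bar>Re D\<bar> + 2)"
      using \<open>Im D \<noteq> 0\<close> by (simp add: d_def)
    moreover have "Re d = -1" by (simp add: d_def)
    ultimately show False using dir[of d] by simp
  qed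
  then have "D = of_real (Re D)" by (simp add: complex_eq_iff)
  then have "z * deriv W z = of_real (Re D) * W z"
    using nz unfolding D_def by (metis nonzero_divide_eq_eq)
  ultimately show ?thesis using that by blast
qed

text \<open>Given the lemniscate equation at \<open>P\<close>, the squared norm minus 1 is a sum of
  two terms whose signs are those of \<open>N + K\<^sup>2 - 1\<close> and
  \<open>4 * N + N\<^sup>2 + K\<^sup>2 - 2\<close>, where \<open>N\<close> is the squared modulus of
  \<open>P\<close>. Neither is negative: if \<open>N\<close> is small, the hypothesis forces
  \<open>K\<close> to be large.\<close>

lemma lemniscate_shift:
  fixes P :: complex and K :: real
  assumes P: "norm (P\<^sup>2 - 1) = 1" "Re P \<ge> 0" "P \<noteq> 0"
    and K: "K * (2 * norm P ^ 4) \<ge> 1.1874"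
  shows "norm ((P + of_real K)\<^sup>2 - 1) \<ge> 1"
proof -
  define u y N where "u = Re P" and "y = Im P" and "N = (norm P)\<^sup>2"
  have N: "N = u\<^sup>2 + y\<^sup>2" by (simp add: N_def u_def y_def cmod_power2)
  have Npos: "N > 0" using P(3) by (simp add: N_def)
  have u0: "u \<ge> 0" using P(2) by (simp add: u_def)
  have sq: "(norm (Q\<^sup>2 - 1))\<^sup>2 = ((Re Q)\<^sup>2 + (Im Q)\<^sup>2)\<^sup>2 - 2 * ((Re Q)\<^sup>2 - (Im Q)\<^sup>2) + 1" for Q :: complex
    unfolding cmod_power2 by (simp add: power2_eq_square algebra_simps)
  have N2: "N\<^sup>2 = 2 * (u\<^sup>2 - y\<^sup>2)"
    using sq[of P] P(1) by (simp add: N u_def y_def)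
  have u2: "4 * u\<^sup>2 = 2 * N + N\<^sup>2" using N N2 by simp
  have KN: "K * (2 * N\<^sup>2) \<ge> 1.1874" using K by (simp add: N_def flip: power_mult)
  then have "K * (2 * N\<^sup>2) > 0" by (rule less_le_trans[rotated]) simp
  then have K0: "K > 0" using Npos by (simp add: zero_less_mult_iff)
  \<comment> \<open>An upper bound on \<open>N\<close> becomes a lower bound on \<open>K\<close>,
    since \<open>K\<close> is at least \<open>1.1874 / (2 * N\<^sup>2)\<close>.\<close>
  have Kge: "K \<ge> a" if "N \<le> b" "a * (2 * b\<^sup>2) \<le> 1.1874" for a b
  proof (rule ccontr)
    assume "\<not> K \<ge> a"
    then have "K * (2 * N\<^sup>2) < a * (2 * N\<^sup>2)" using Npos by simp
    also have "\<dots> \<le> a * (2 * b\<^sup>2)"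
      using that(1) Npos K0 \<open>\<not> K \<ge> a\<close> by (intro mult_left_mono power_mono) auto
    finally show False using that(2) KN by simp
  qed
  have i1: "N + K\<^sup>2 \<ge> 1"
  proof -
    \<comment> \<open>The split at 0.7 lets constant bounds suffice: 0.7 + 0.59^2 > 1 on the middle
      range, and \<open>K \<ge> 1\<close> below it.\<close>
    consider "N \<ge> 1" | "0.7 \<le> N" "N \<le> 1" | "N \<le> 0.7" by linarith
    then show ?thesis
    proof cases
      case 2
      then have "K \<ge> 0.59" by (intro Kge[of 1]) auto
      then have "0.59\<^sup>2 \<le> K\<^sup>2" by (intro power_mono) auto
      then show ?thesis using 2 by (simp add: power2_eq_square)
    next
      case 3
      then have "K \<ge> 1" by (intro Kge[of "0.7"]) (auto simp: power2_eq_square)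
      then have "1\<^sup>2 \<le> K\<^sup>2" by (intro power_mono) auto
      then show ?thesis using Npos by simp
    qed (simp add: add_increasing2)
  qed
  have i2: "4 * N + N\<^sup>2 + K\<^sup>2 \<ge> 2"
  proof (cases "N \<ge> 0.5")
    case False
    then have "K \<ge> 2" by (intro Kge[of "0.5"]) (auto simp: power2_eq_square)
    then have "2\<^sup>2 \<le> K\<^sup>2" by (intro power_mono) auto
    then show ?thesis using Npos zero_le_power2[of N] by (simp add: add_increasing)
  next
    case True
    then have "4 * N \<ge> 2" by simp
    then show ?thesis using zero_le_power2[of N] zero_le_power2[of K] by linarith
  qed
  have "(norm ((P + of_real K)\<^sup>2 - 1))\<^sup>2 = (N + 2 * u * K + K\<^sup>2)\<^sup>2 - 2 * ((u + K)\<^sup>2 - y\<^sup>2) + 1"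
    unfolding sq by (simp add: N u_def y_def power2_eq_square algebra_simps)
  \<comment> \<open>The terms are grouped so that the first two brackets vanish by \<open>N2\<close>
    and \<open>u2\<close>.\<close>
  also have "\<dots> = 1 + (N\<^sup>2 - 2 * (u\<^sup>2 - y\<^sup>2)) + (4 * u\<^sup>2 - (2 * N + N\<^sup>2)) * K\<^sup>2
      + 4 * u * K * (N + K\<^sup>2 - 1) + K\<^sup>2 * (4 * N + N\<^sup>2 + K\<^sup>2 - 2)"
    by (simp add: power2_eq_square algebra_simps)
  also have "\<dots> = 1 + 4 * u * K * (N + K\<^sup>2 - 1) + K\<^sup>2 * (4 * N + N\<^sup>2 + K\<^sup>2 - 2)"
    using N2 u2 by simp
  also have "\<dots> \<ge> 1" using u0 K0 i1 i2 by simp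
  finally show ?thesis by (metis norm_ge_zero one_power2 power2_le_imp_le)
qed

text \<open>The open lemniscate misses the imaginary axis, where the square minus 1 is real and at
  most -1. A connected image therefore stays in one of the two loops.\<close>

lemma Re_pos_if_in_lemniscate:
  assumes cont: "continuous_on S p" and conn: "connected S"
    and a: "a \<in> S" "Re (p a) > 0"
    and lem: "\<And>z. z \<in> S \<Longrightarrow> norm ((p z)\<^sup>2 - 1) < 1"
    and z: "z \<in> S"
  shows "Re (p z) > 0"
proof (rule ccontr)
  assume "\<not> Re (p z) > 0"
  moreover have "connected ((\<lambda>z. Re (p z)) ` S)"
    by (intro connected_continuous_image continuous_intros cont conn)
  ultimately have "0 \<in> (\<lambda>z. Re (p z)) ` S"
    using connectedD_interval[of _ "Re (p z)" "Re (p a)" 0] a z by auto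
  then obtain x where x: "x \<in> S" "Re (p x) = 0" by auto
  then have "Re ((p x)\<^sup>2 - 1) \<le> -1" by (simp add: Re_power2)
  then have "norm ((p x)\<^sup>2 - 1) \<ge> 1"
    using abs_Re_le_cmod[of "(p x)\<^sup>2 - 1"] by linarith
  with lem[OF x(1)] show False by simp
qed

text \<open>At a zero of order \<open>n\<close> the left-hand side of \<open>eq\<close> vanishes to order \<open>n - 1\<close> only, the right-hand
  side at least to order \<open>3 n\<close>.\<close>

lemma nonzero_if_deriv_eq_cube:
  fixes p :: "complex \<Rightarrow> complex"
  assumes p: "p holomorphic_on S" and h: "continuous_on S h" and S: "open S" "connected S"
    and a: "a \<in> S" "p a \<noteq> 0"
    and eq: "\<And>z. z \<in> S \<Longrightarrow> p z \<noteq> 0 \<Longrightarrow> z * deriv p z = h z * p z ^ 3"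
    and z: "z \<in> S" "z \<noteq> 0"
  shows "p z \<noteq> 0"
proof
  assume pz: "p z = 0"
  have nc: "\<not> p constant_on S"
    using a z pz unfolding constant_on_def by metis
  from holomorphic_factor_zero_nonconstant[OF p S z(1) pz nc]
  obtain g r n where n: "0 < n" and r: "0 < r" "ball z r \<subseteq> S" and g: "g holomorphic_on ball z r"
    and pg: "\<And>w. w \<in> ball z r \<Longrightarrow> p w = (w - z) ^ n * g w"
    and g0: "\<And>w. w \<in> ball z r \<Longrightarrow> g w \<noteq> 0"
    by metis
  \<comment> \<open>\<open>L\<close> and \<open>M\<close> are the two sides of \<open>eq\<close>
    divided by \<open>(w - z) ^ (n - 1)\<close>; the exponent in \<open>M\<close> is 3n - (n - 1).
    They agree off \<open>z\<close>, hence by continuity at \<open>z\<close>, where \<open>M\<close>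
    vanishes and \<open>L\<close> does not.\<close>
  define L where "L = (\<lambda>w. w * (of_nat n * g w + (w - z) * deriv g w))"
  define M where "M = (\<lambda>w. (w - z) ^ (2 * n + 1) * (h w * g w ^ 3))"
  have LM: "L w = M w" if w: "w \<in> ball z r" "w \<noteq> z" for w
  proof -
    have "(g has_field_derivative deriv g w) (at w)"
      by (rule holomorphic_derivI[OF g]) (use w in auto)
    then have "((\<lambda>w. (w - z) ^ n * g w) has_field_derivative
        of_nat n * (w - z) ^ (n - 1) * g w + (w - z) ^ n * deriv g w) (at w)"
      by (auto intro!: derivative_eq_intros)
    then have "(p has_field_derivative
        of_nat n * (w - z) ^ (n - 1) * g w + (w - z) ^ n * deriv g w) (at w)"
      by (rule has_field_derivative_transform_within_open[of _ _ _ "ball z r"]) (use w pg in auto)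
    then have "deriv p w = of_nat n * (w - z) ^ (n - 1) * g w + (w - z) ^ n * deriv g w"
      by (rule DERIV_imp_deriv)
    also have "\<dots> = (w - z) ^ (n - 1) * (of_nat n * g w + (w - z) * deriv g w)"
      using n by (cases n) (auto simp: algebra_simps)
    finally have "w * deriv p w = (w - z) ^ (n - 1) * L w"
      by (simp add: L_def)
    moreover have "p w \<noteq> 0" using pg[OF w(1)] g0[OF w(1)] w(2) by simp
    then have "w * deriv p w = h w * p w ^ 3" using eq w r by blast
    moreover have "h w * p w ^ 3 = (w - z) ^ (n - 1) * M w"
    proof -
      have "(w - z) ^ (n - 1) * (w - z) ^ (2 * n + 1) = ((w - z) ^ n) ^ 3"
        using n by (cases n) (auto simp: power_mult power3_eq_cube power2_eq_square algebra_simps power_mult_distrib simp flip: power_add)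
      from this[symmetric] show ?thesis
        by (simp only: M_def pg[OF w(1)] power_mult_distrib mult_ac)
    qed
    ultimately have "(w - z) ^ (n - 1) * L w = (w - z) ^ (n - 1) * M w" by metis
    then show ?thesis using w(2) by (metis mult_left_cancel power_not_zero right_minus_eq)
  qed
  have zb: "z \<in> ball z r" using r by simp
  have cg: "continuous_on (ball z r) g" "continuous_on (ball z r) (deriv g)"
    using g by (auto intro!: holomorphic_on_imp_continuous_on holomorphic_deriv)
  have "continuous_on (ball z r) L" "continuous_on (ball z r) M"
    unfolding L_def M_def
    by (intro continuous_intros cg continuous_on_subset[OF h r(2)])+
  then have "isCont L z" "isCont M z"
    using continuous_on_interior zb by (metis interior_open open_ball)+
  then have "L \<midarrow>z\<rightarrow> L z" "M \<midarrow>z\<rightarrow> M z" by (auto simp: isCont_def)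
  moreover have "\<forall>\<^sub>F w in at z. L w = M w"
    unfolding eventually_at using LM r by (auto simp: dist_commute)
  ultimately have "L z = M z"
    by (metis LIM_unique tendsto_cong)
  then have "z * (of_nat n * g z) = 0" by (simp add: L_def M_def)
  then show False using z n g0[OF zb] by simp
qed

theorem lemma3p2:
  fixes p :: "complex \<Rightarrow> complex" and \<beta> :: real
  assumes "p analytic_on \<D>"
    and "p 0 = 1"
    and "\<beta> > 1.1874"
    and "(\<lambda>z. p z + of_real \<beta> * z * deriv p z / p z ^ 3) \<prec> (\<lambda>z. csqrt (1 + z))"
  shows "p \<prec> (\<lambda>z. csqrt (1 + z))"
proof -
  define f where "f = (\<lambda>z. p z + of_real \<beta> * z * deriv p z / p z ^ 3)"
  obtain w where an: "f analytic_on \<D>" "(\<lambda>z. csqrt (1 + z)) analytic_on \<D>"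
    and w: "w ` \<D> \<subseteq> \<D>" "\<And>z. z \<in> \<D> \<Longrightarrow> f z = csqrt (1 + w z)"
    using assms(4) unfolding subordinate_def f_def by blast
  have holo: "p holomorphic_on \<D>" "f holomorphic_on \<D>"
    using assms(1) an(1) by (auto simp: analytic_on_open)
  have cont: "continuous_on \<D> p" "continuous_on \<D> f"
    using holo by (auto intro: holomorphic_on_imp_continuous_on)
  have f_in: "norm ((f z)\<^sup>2 - 1) < 1" if "z \<in> \<D>" for z
    using w that by (auto simp: image_subset_iff)
  have nz: "p z \<noteq> 0" if z: "z \<in> \<D>" for z
  proof (cases "z = 0")
    case False
    \<comment> \<open>Analyticity of the left-hand side \<open>f\<close> enters here: it makes
      \<open>(f z - p z) / of_real \<beta>\<close> continuous even across a possible zero of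
      \<open>p\<close>, where the formula for \<open>f\<close> only gives the default value of
      division by zero.\<close>
    show ?thesis
    proof (rule nonzero_if_deriv_eq_cube[OF holo(1)])
      show "continuous_on \<D> (\<lambda>z. (f z - p z) / of_real \<beta>)"
        using assms(3) by (intro continuous_intros cont) auto
      show "x * deriv p x = (f x - p x) / of_real \<beta> * p x ^ 3" if "p x \<noteq> 0" for x
        using that assms(3) by (simp add: f_def field_simps)
      show "(0::complex) \<in> \<D>" "p 0 \<noteq> 0" using assms(2) by auto
    qed (use z False in auto)
  qed (simp add: assms(2))
  define W where "W = (\<lambda>z. (p z)\<^sup>2 - 1)"
  have W: "W holomorphic_on \<D>" unfolding W_def by (intro holomorphic_intros holo)
  then have Wcont: "continuous_on \<D> W" by (rule holomorphic_on_imp_continuous_on)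
  have W0: "W 0 = 0" by (simp add: W_def assms(2))
  have W_less: "norm (W z) < 1" if z: "z \<in> \<D>" for z
  proof (rule ccontr)
    assume "\<not> norm (W z) < 1"
    \<comment> \<open>Compactness of this set of failures provides a failure \<open>a\<close> of
      least modulus, to which \<open>Jack\<close> applies.\<close>
    define C where "C = {x \<in> cball 0 (norm z). norm (W x) \<in> {1..}}"
    have sub: "cball 0 (norm z) \<subseteq> \<D>" using z by auto
    have "closed C" unfolding C_def
      by (rule continuous_closed_preimage[unfolded vimage_def, simplified Int_def mem_Collect_eq])
        (auto intro!: continuous_intros continuous_on_subset[OF Wcont sub])
    moreover have "bounded C" by (rule bounded_subset[OF bounded_cball[of 0 "norm z"]]) (auto simp: C_def)
    ultimately have "compact C" by (simp add: compact_eq_bounded_closed)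
    moreover have "z \<in> C" using \<open>\<not> norm (W z) < 1\<close> by (simp add: C_def)
    ultimately obtain a where a: "a \<in> C" "\<And>x. x \<in> C \<Longrightarrow> norm a \<le> norm x"
      using continuous_attains_inf[of C norm] by (auto intro: continuous_intros)
    have a1: "norm a < 1" and aW: "norm (W a) \<ge> 1" using a z by (auto simp: C_def)
    have a0: "a \<noteq> 0" using aW W0 by auto
    have less: "norm (W x) < 1" if "norm x < norm a" for x
      using a(2)[of x] that a(1) by (force simp: C_def)
    have cl: "closure (ball (0 :: complex) (norm a)) = cball 0 (norm a)" using a0 by simp
    have sub': "cball 0 (norm a) \<subseteq> \<D>" using a1 by auto
    have "norm (W a) \<le> 1"
    proof (rule continuous_le_on_closure[where S = "ball 0 (norm a)" and f = "\<lambda>x. norm (W x)"])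
      show "continuous_on (closure (ball 0 (norm a))) (\<lambda>x. norm (W x))"
        unfolding cl by (intro continuous_intros continuous_on_subset[OF Wcont sub'])
      show "a \<in> closure (ball 0 (norm a))" unfolding cl by simp
      show "norm (W x) \<le> 1" if "x \<in> ball 0 (norm a)" for x using less[of x] that by simp
    qed
    with aW have Wa: "norm (W a) = 1" by simp
    obtain m where m: "m \<ge> 1" "a * deriv W a = of_real m * W a"
      using Jack[OF W W0 a1 Wa less] .
    define P where "P = p a"
    have P0: "P \<noteq> 0" using nz a1 by (simp add: P_def)
    \<comment> \<open>On the open disc of radius \<open>norm a\<close> the values of
      \<open>p\<close> lie in the right loop, because \<open>p 0 = 1\<close>; the weak inequality
      passes to the boundary point \<open>a\<close>.\<close>
    have "Re P \<ge> 0" unfolding P_def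
    proof (rule continuous_ge_on_closure[where S = "ball 0 (norm a)" and f = "\<lambda>x. Re (p x)"])
      show "continuous_on (closure (ball 0 (norm a))) (\<lambda>x. Re (p x))"
        unfolding cl by (intro continuous_intros continuous_on_subset[OF cont(1) sub'])
      show "a \<in> closure (ball 0 (norm a))" unfolding cl by simp
      show "Re (p x) \<ge> 0" if x: "x \<in> ball 0 (norm a)" for x
      proof (rule less_imp_le, rule Re_pos_if_in_lemniscate[where p = p and S = "ball 0 (norm a)" and a = 0])
        show "continuous_on (ball 0 (norm a)) p"
          by (rule continuous_on_subset[OF cont(1)]) (use a1 in auto)
      qed (use x a0 less assms(2) in \<open>auto simp: W_def\<close>)
    qed
    have "(p has_field_derivative deriv p a) (at a)"
      by (rule holomorphic_derivI[OF holo(1)]) (use a1 in auto)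
    then have "(W has_field_derivative 2 * P * deriv p a) (at a)"
      unfolding W_def P_def by (auto intro!: derivative_eq_intros)
    then have "deriv W a = 2 * P * deriv p a" by (rule DERIV_imp_deriv)
    with m(2) have dp: "2 * P * (a * deriv p a) = of_real m * W a" by (simp add: mult_ac)
    define K where "K = \<beta> * m / (2 * norm P ^ 4)"
    \<comment> \<open>\<open>W(a)\<close> is unimodular, so \<open>(1 + W(a))\<^sup>2 = W(a) \<bar>1 + W(a)\<bar>\<^sup>2\<close>.\<close>
    have P4: "P ^ 4 = W a * of_real (norm P ^ 4)"
    proof -
      have P2: "P\<^sup>2 = 1 + W a" by (simp add: W_def P_def)
      have WW: "W a * cnj (W a) = 1" using complex_norm_square[of "W a"] Wa by simp
      have "of_real (norm P ^ 4) = (of_real ((norm (P\<^sup>2))\<^sup>2) :: complex)"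
        by (simp add: norm_power flip: power_mult)
      also have "\<dots> = (1 + W a) * cnj (1 + W a)" unfolding complex_norm_square P2 ..
      finally have "W a * of_real (norm P ^ 4) = (1 + W a) * (W a + W a * cnj (W a))"
        by (simp add: algebra_simps)
      also have "\<dots> = (P\<^sup>2)\<^sup>2" unfolding WW P2 by (simp add: power2_eq_square algebra_simps)
      finally show ?thesis by (simp flip: power_mult)
    qed
    have "f a = P + of_real K"
    proof -
      \<comment> \<open>Extending the fraction by \<open>2 * P\<close> brings it into the form of
        \<open>dp\<close> and \<open>P4\<close>; the factor \<open>W a\<close> then cancels and a
        real number remains.\<close>
      have "of_real \<beta> * a * deriv p a / P ^ 3 = of_real \<beta> * (2 * P * (a * deriv p a)) / (2 * P ^ 4)"
        using P0 by (simp add: field_simps power3_eq_cube power4_eq_xxxx)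
      also have "\<dots> = of_real K"
        unfolding dp P4 K_def using Wa by (auto simp: field_simps)
      finally show ?thesis by (simp add: f_def P_def)
    qed
    moreover have "norm ((P + of_real K)\<^sup>2 - 1) \<ge> 1"
    proof (rule lemniscate_shift)
      show "norm (P\<^sup>2 - 1) = 1" using Wa by (simp add: W_def P_def)
      have "\<beta> * m \<ge> \<beta> * 1" using m(1) assms(3) by (intro mult_left_mono) auto
      moreover have "K * (2 * norm P ^ 4) = \<beta> * m" using P0 by (simp add: K_def)
      ultimately show "K * (2 * norm P ^ 4) \<ge> 1.1874" using assms(3) by linarith
    qed fact+
    ultimately show False using f_in[of a] a1 by simp
  qed
  \<comment> \<open>\<open>W\<close> itself is the map required by subordination: \<open>p z\<close>
    is the square root of \<open>1 + W z\<close> with positive real part, that is, the principal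
    one.\<close>
  have "p z = csqrt (1 + W z)" if z: "z \<in> \<D>" for z
  proof -
    have "Re (p z) > 0"
      by (rule Re_pos_if_in_lemniscate[where p = p and S = \<D> and a = 0])
        (use z cont(1) W_less assms(2) in \<open>auto simp: W_def\<close>)
    then have "csqrt (1 + W z) = p z" by (intro csqrt_unique) (auto simp: W_def)
    then show ?thesis ..
  qed
  moreover have "W analytic_on \<D>" using W by (simp add: analytic_on_open)
  ultimately show ?thesis
    unfolding subordinate_def using assms(1) an(2) W0 W_less by (auto intro!: exI[of _ W])
qed

end
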